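(* Let $c\in(0,1)$, and let $u,v,\tau^\ast,\tau_c$ be as defined in the context. For $n=(n_1,n_2,n_3,n_4)\in\mathbb Z^4$ set $$r=(r_1,r_2,r_3,r_4)=n\,{}^tL,\qquad L=\begin{pmatrix}1&1&1&1\\ 1&1&1&-1\\ 1&1&2&0\\ 1&-1&0&0\end{pmatrix},\qquad \det L=-4.$$ Then $n\mapsto r$ is a bijection of $\mathbb Z^4$ onto the index-$4$ sublattice $\{r\in\mathbb Z^4: r_1\equiv r_2,\ r_3\equiv r_4 \pmod 2\}$, with inverse $$n_1=\frac{r_1+r_2-r_3+r_4}{2},\quad n_2=\frac{r_1+r_2-r_3-r_4}{2},\quad n_3=r_3-\frac{r_1+r_2}{2},\quad n_4=\frac{r_1-r_2}{2}.$$ Moreover, $$\frac12\,n\,\tau_c\,{}^tn=\frac{\tau^\ast}{4}r_1^2-\frac1{4\tau^\ast}r_2^2+\frac i4r_3^2+\frac i4r_4^2 .$$ For $a,b\in\mathbb Z^4$ set $\alpha=a\,{}^tL$ and $\beta=bL^{-1}$, whose components are $$(\alpha_1,\alpha_2,\alpha_3,\alpha_4)=(a_1+a_2+a_3+a_4,\ a_1+a_2+a_3-a_4,\ a_1+a_2+2a_3,\ a_1-a_2),$$ $$(\beta_1,\beta_2,\beta_3,\beta_4)=\Big(\tfrac{b_1+b_2-b_3+b_4}2,\ \tfrac{b_1+b_2-b_3-b_4}2,\ b_3-\tfrac{b_1+b_2}2,\ \tfrac{b_1-b_2}2\Big).$$ Consequently, $$\vartheta\Big[{a\atop b}\Big](\tau_c)=\frac14\sum_{\nu_1,\nu_2\in\{0,1\}}e^{-2\pi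 i\frac{(\alpha_1+\alpha_2)\nu_1+(\alpha_3+\alpha_4)\nu_2}{4}}\,\vartheta_{\alpha_1,\beta_1+\nu_1}\!\big(\tfrac{\tau^\ast}2\big)\,\vartheta_{\alpha_2,\beta_2+\nu_1}\!\big(-\tfrac1{2\tau^\ast}\big)\,\vartheta_{\alpha_3,\beta_3+\nu_2}\!\big(\tfrac i2\big)\,\vartheta_{\alpha_4,\beta_4+\nu_2}\!\big(\tfrac i2\big).$$
   Context: For $c\in(0,1)$ put $$\mathcal K_1=\int_0^c\frac{dz}{(z^3(c-z)^3(1-z))^{1/4}},\qquad \mathcal K_2=\int_c^1\frac{dz}{(z^3(z-c)^3(1-z))^{1/4}}$$ (positive real fourth roots), $v=2i\mathcal K_1$, $u=2i(\mathcal K_1-\sqrt2\,\mathcal K_2)$, and $\tau^\ast=-i\,\dfrac{u+v}{u-v}$. It is known that $u^2-v^2>0$ and $\tau^\ast,-1/\tau^\ast\in i\mathbb R_{>0}$. Put $$\tau_c=-\frac{i}{u^2-v^2}\begin{pmatrix} 2v^2 & u^2+v^2 & 2v^2 & 2uv \\ u^2+v^2 & 2v^2 & 2v^2 & 2uv \\ 2v^2 & 2v^2 & 3v^2-u^2 & 2uv \\ 2uv & 2uv & 2uv & u^2+v^2 \end{pmatrix},$$ which lies in the Siegel upper half-space of degree 4. Theta constants: for $\tau$ in the Siegel upper half-space of degree $n$ and row vectors $a,b$ (integral, or more generally real), $$\vartheta\Big[{a\atop b}\Big](\tau)=\sum_{k\in\mathbb Z^n}\exp2\pi i\Big(\tfrac12(k+\tfrac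 a2)\tau\,{}^t(k+\tfrac a2)+(k+\tfrac a2)\,{}^t(\tfrac b2)\Big).$$ For $n=1$ and real $a,b$ this is written $\vartheta_{a,b}(\tau)$. *)

theory Defs
  imports "HOL-Analysis.Analysis" "HOL-Algebra.Coset" "HOL-Number_Theory.Cong"
begin

lemma vector_4 [simp]:
  fixes x y z w :: "'a::zero"
  shows "(vector [x, y, z, w] :: 'a^4) $ 1 = x"
    and "(vector [x, y, z, w] :: 'a^4) $ 2 = y"
    and "(vector [x, y, z, w] :: 'a^4) $ 3 = z"
    and "(vector [x, y, z, w] :: 'a^4) $ 4 = w"
  unfolding vector_def by simp_all

text \<open>
  The improper integrals are Henstock-Kurzweil integrals over the closed interval; the integrand
  is \<open>1 / 0 = 0\<close> at the singular end points.  On the range of integration the radicand is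
  nonnegative, so \<open>root 4\<close> is the nonnegative real fourth root.
\<close>

definition K1 :: "real \<Rightarrow> real" where
  "K1 c = integral {0..c} (\<lambda>z. 1 / root 4 (z ^ 3 * (c - z) ^ 3 * (1 - z)))"

definition K2 :: "real \<Rightarrow> real" where
  "K2 c = integral {c..1} (\<lambda>z. 1 / root 4 (z ^ 3 * (z - c) ^ 3 * (1 - z)))"

definition per_v :: "real \<Rightarrow> complex" where
  "per_v c = 2 * \<i> * complex_of_real (K1 c)"

definition per_u :: "real \<Rightarrow> complex" where
  "per_u c = 2 * \<i> * complex_of_real (K1 c - sqrt 2 * K2 c)"

definition tau_star :: "real \<Rightarrow> complex" where
  "tau_star c = - \<i> * ((per_u c + per_v c) / (per_u c - per_v c))"

definition tau_mat :: "real \<Rightarrow> complex^4^4" where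
  "tau_mat c = (let u = per_u c; v = per_v c in
     (\<chi> i j. - (\<i> / (u\<^sup>2 - v\<^sup>2)) *
       (vector
         [vector [2 * v\<^sup>2,    u\<^sup>2 + v\<^sup>2, 2 * v\<^sup>2,      2 * u * v],
          vector [u\<^sup>2 + v\<^sup>2, 2 * v\<^sup>2,    2 * v\<^sup>2,      2 * u * v],
          vector [2 * v\<^sup>2,    2 * v\<^sup>2,    3 * v\<^sup>2 - u\<^sup>2, 2 * u * v],
          vector [2 * u * v,  2 * u * v,  2 * u * v,    u\<^sup>2 + v\<^sup>2]] :: complex^4^4) $ i $ j))"

definition of_int_vec :: "int^'n \<Rightarrow> 'a::ring_1^'n" where
  "of_int_vec x = (\<chi> i. of_int (x $ i))"

text \<open>\<open>x \<tau> \<^sup>tx\<close> for a row vector \<open>x\<close>; bilinear, without complex conjugation.\<close>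

definition quad_form :: "complex^'n^'n \<Rightarrow> complex^'n \<Rightarrow> complex" where
  "quad_form \<tau> x = (\<Sum>i\<in>UNIV. \<Sum>j\<in>UNIV. x $ i * \<tau> $ i $ j * x $ j)"

text \<open>
  The series is meant for \<open>\<tau>\<close> in the Siegel upper half-space, where it converges absolutely; the
  definition is total because \<^term>\<open>infsum\<close> is.
\<close>

definition theta :: "real^'n \<Rightarrow> real^'n \<Rightarrow> complex^'n^'n \<Rightarrow> complex" where
  "theta a b \<tau> = (\<Sum>\<^sub>\<infinity>k\<in>(UNIV :: (int^'n) set).
     (let x = (\<chi> i. complex_of_real (of_int (k $ i) + a $ i / 2))
      in exp (2 * pi * \<i> *
           (1 / 2 * quad_form \<tau> x + (\<Sum>i\<in>UNIV. x $ i * complex_of_real (b $ i / 2))))))"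

definition theta1 :: "real \<Rightarrow> real \<Rightarrow> complex \<Rightarrow> complex" where
  "theta1 a b \<tau> = theta (vec a :: real^1) (vec b) (\<chi> i j. \<tau>)"

definition L_mat :: "'a::ring_1^4^4" where
  "L_mat = vector
     [vector [1,  1, 1,  1],
      vector [1,  1, 1, -1],
      vector [1,  1, 2,  0],
      vector [1, -1, 0,  0]]"

text \<open>Row vectors act from the left by \<open>v*\<close>, so this is \<open>n \<mapsto> n \<^sup>tL\<close>.\<close>

definition L_map :: "int^4 \<Rightarrow> int^4" where
  "L_map n = n v* transpose L_mat"

definition beta_vec :: "int^4 \<Rightarrow> real^4" where
  "beta_vec b = of_int_vec b v* matrix_inv L_mat"

definition Z4 :: "(int^4) monoid" where
  "Z4 = \<lparr>carrier = UNIV, monoid.mult = (+), one = 0\<rparr>"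

definition Lambda :: "(int^4) set" where
  "Lambda = {r. [r $ 1 = r $ 2] (mod 2) \<and> [r $ 3 = r $ 4] (mod 2)}"

end

theory Submission
  imports Defs
begin

text \<open>
  The substitutions \<open>z = c t\<close> and \<open>z = c / (c + (1 - c) t)\<close> turn \<open>K1 c\<close> and \<open>K2 c\<close> into
  integrals over the unit interval whose integrands \<open>F1\<close> and \<open>F2\<close> satisfy \<open>1 \<le> F2 \<le> F1\<close>
  pointwise, while \<open>F1\<close> is dominated by a Beta integrand.  Hence \<open>0 < K2 c < sqrt 2 * K1 c\<close>, so
  \<open>tau_star c\<close> lies on the positive imaginary axis and every theta series converges absolutely.
  In the coordinates \<open>r = L_map n\<close> the quadratic form is diagonal, so the theta series of
  \<open>tau_mat c\<close> is a sum over \<open>Lambda\<close> of products of four one-dimensional terms.  Shifting a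
  characteristic by \<open>\<nu>\<close> multiplies the \<open>k\<close>-th term by \<open>(-1) ^ (k \<nu>)\<close> up to a constant, so
  averaging over \<open>\<nu>\<close> is the indicator function of a parity condition.
\<close>

subsection \<open>The periods\<close>

lemma root_fourth_scale:
  fixes p x :: real
  assumes "0 \<le> p"
  shows "root 4 (p ^ 4 * x) = p * root 4 x"
  using assms by (simp add: real_root_mult real_root_power_cancel)

text \<open>Integrability is demanded only of the pulled-back integrand \<open>F\<close>, so the
  singular integrands of \<open>K1\<close> and \<open>K2\<close> never have to be bounded in the
  original variable.\<close>

lemma integral_image_eq:
  fixes f F g g' :: "real \<Rightarrow> real"
  assumes "F absolutely_integrable_on S" and "S \<in> sets lebesgue" and "inj_on g S"
    and "\<And>t. t \<in> S \<Longrightarrow> (g has_field_derivative g' t) (at t within S)"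
    and "\<And>t. t \<in> S \<Longrightarrow> \<bar>g' t\<bar> * f (g t) = F t"
  shows "integral (g ` S) f = integral S F"
proof -
  have "(\<lambda>t. \<bar>g' t\<bar> * f (g t)) absolutely_integrable_on S"
    using assms(5) by (intro absolutely_integrable_spike[OF assms(1) negligible_empty]) simp
  moreover have "integral S (\<lambda>t. \<bar>g' t\<bar> * f (g t)) = integral S F"
    using assms(5) by (intro integral_cong) simp
  ultimately show ?thesis
    using has_absolute_integral_change_of_variables_1'[OF assms(2,4,3), of f "integral S F"] by simp
qed

text \<open>The integrand of \<open>K1\<close> pulled back along \<open>z = c * t\<close>. The
  Jacobian \<open>c\<close> enters the radicand as a division by \<open>c ^ 4\<close> and leaves
  \<open>c ^ 2\<close> of the factor \<open>c ^ 6\<close>.\<close>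

definition K1_integrand :: "real \<Rightarrow> real \<Rightarrow> real" where
  "K1_integrand c t = 1 / root 4 (c\<^sup>2 * t ^ 3 * (1 - t) ^ 3 * (1 - c * t))"

text \<open>The integrand of \<open>K2\<close> pulled back along
  \<open>z = c / (c + (1 - c) * t)\<close>, which reverses orientation: \<open>t = 0\<close>
  corresponds to \<open>z = 1\<close>. This choice produces the factors \<open>c ^ 2\<close> and
  \<open>(1 - t) ^ 3\<close> of \<open>K1_integrand\<close>, so the two can be compared
  pointwise.\<close>

definition K2_integrand :: "real \<Rightarrow> real \<Rightarrow> real" where
  "K2_integrand c t = 1 / root 4 (c\<^sup>2 * t * (1 - t) ^ 3 * (c + (1 - c) * t))"

lemma K1_integrand_absolutely_integrable:
  assumes "0 < c" "c < 1"
  shows "K1_integrand c absolutely_integrable_on {0<..<1}"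
proof -
  let ?F = "K1_integrand c"
  \<comment> \<open>On the unit interval \<open>1 - c * t\<close> is at least \<open>1 - c\<close>;
    replacing it by this constant leaves a multiple of the Beta integrand with both parameters
    \<open>1/4\<close>.\<close>
  define C where "C = 1 / root 4 (c\<^sup>2 * (1 - c))"
  let ?g = "\<lambda>t::real. C * (t powr (1/4 - 1) * (1 - t) powr (1/4 - 1))"
  have bound: "norm (?F t) \<le> ?g t" if t: "t \<in> {0<..<1}" for t
  proof -
    from t have t: "0 < t" "t < 1" by auto
    have ct: "c * t < 1"
      using mult_strict_mono[of c 1 t 1] t assms by simp
    have ctc: "c * t \<le> c"
      using mult_left_le[of t c] t assms by simp
    have "0 < c\<^sup>2 * t ^ 3 * (1 - t) ^ 3 * (1 - c * t)"
      using assms t ct by (intro mult_pos_pos) auto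
    then have pos: "0 < root 4 (c\<^sup>2 * t ^ 3 * (1 - t) ^ 3 * (1 - c * t))"
      by simp
    have r: "root 4 (x ^ 3) = x powr (3/4)" if "x > 0" for x
      using that by (simp add: root_powr_inverse powr_powr flip: powr_numeral)
    have "root 4 (c\<^sup>2 * (1 - c)) * (t powr (3/4) * (1 - t) powr (3/4))
        = root 4 (c\<^sup>2 * t ^ 3 * (1 - t) ^ 3 * (1 - c))"
      using t r[of t] r[of "1 - t"] by (simp add: real_root_mult)
    also have "\<dots> \<le> root 4 (c\<^sup>2 * t ^ 3 * (1 - t) ^ 3 * (1 - c * t))"
      using t ct ctc assms by (intro real_root_le_mono mult_left_mono) auto
    finally have "1 / root 4 (c\<^sup>2 * t ^ 3 * (1 - t) ^ 3 * (1 - c * t))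
        \<le> 1 / (root 4 (c\<^sup>2 * (1 - c)) * (t powr (3/4) * (1 - t) powr (3/4)))"
      using t assms by (intro divide_left_mono mult_pos_pos) (auto simp: ct)
    also have "\<dots> = ?g t"
      by (simp add: C_def powr_minus divide_simps)
    finally show ?thesis
      using pos by (simp only: K1_integrand_def real_norm_def abs_of_pos divide_pos_pos zero_less_one)
  qed
  have "(\<lambda>t::real. t powr (1/4 - 1) * (1 - t) powr (1/4 - 1)) integrable_on {0<..<1}"
    using has_integral_Beta_real[of "1/4" "1/4"]
    by (intro has_integral_integrable) (simp add: has_integral_Icc_iff_Ioo)
  then have gint: "?g integrable_on {0<..<1}"
    by (rule integrable_on_mult_right)
  have meas: "?F \<in> borel_measurable (lebesgue_on {0<..<1})"
    unfolding K1_integrand_def by (intro measurable_restrict_space1 measurable_completion) measurable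
  show ?thesis
    by (rule measurable_bounded_by_integrable_imp_absolutely_integrable[OF meas _ gint bound]) auto
qed

lemma K1_eq:
  assumes "0 < c" "c < 1"
  shows "K1 c = integral {0<..<1} (K1_integrand c)"
proof -
  have eq: "\<bar>c\<bar> * (1 / root 4 ((c * t) ^ 3 * (c - c * t) ^ 3 * (1 - c * t))) = K1_integrand c t" for t
  proof -
    have "(c * t) ^ 3 * (c - c * t) ^ 3 * (1 - c * t) = c ^ 4 * (c\<^sup>2 * t ^ 3 * (1 - t) ^ 3 * (1 - c * t))"
      by algebra
    then show ?thesis
      using assms by (simp only: K1_integrand_def root_fourth_scale[OF less_imp_le]) simp
  qed
  have der: "((*) c has_field_derivative c) (at t within {0<..<1})" for t
    by (auto intro!: derivative_eq_intros)
  have "integral ((*) c ` {0<..<1}) (\<lambda>z. 1 / root 4 (z ^ 3 * (c - z) ^ 3 * (1 - z)))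
      = integral {0<..<1} (K1_integrand c)"
    by (rule integral_image_eq[OF K1_integrand_absolutely_integrable[OF assms] _ _ der eq])
      (use assms in \<open>simp_all add: inj_on_def\<close>)
  moreover have "(*) c ` {0<..<1} = {0<..<c}"
  proof (intro equalityI subsetI)
    fix z assume "z \<in> {0<..<c}"
    then show "z \<in> (*) c ` {0<..<1}"
      using assms by (intro image_eqI[of _ _ "z / c"]) auto
  qed (use assms in auto)
  ultimately show ?thesis
    unfolding K1_def by (simp only: integral_open_interval_real)
qed

text \<open>Every factor of the second radicand is at most 1, hence the lower bound. After removal
  of the common factor \<open>c ^ 2 * t * (1 - t) ^ 3\<close>, the upper bound amounts to
  \<open>t ^ 2 * (1 - c * t) <= t <= D\<close>.\<close>

lemma K2_integrand_bounds:
  assumes "0 < c" "c < 1" "0 < t" "t < 1"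
  shows "1 \<le> K2_integrand c t" and "K2_integrand c t \<le> K1_integrand c t"
proof -
  define D where "D = c + (1 - c) * t"
  have D: "t \<le> D" "D \<le> 1"
    using mult_left_le[of t c] mult_left_le[of "1 - t" c] mult_nonneg_nonneg[of c "1 - t"]
      mult_nonneg_nonneg[of "1 - c" "1 - t"] assms
    unfolding D_def by (simp_all add: algebra_simps)
  have ct: "0 < 1 - c * t" "1 - c * t \<le> 1"
    using mult_strict_mono[of c 1 t 1] assms by auto
  have pos1: "0 < root 4 (c\<^sup>2 * t ^ 3 * (1 - t) ^ 3 * (1 - c * t))"
    unfolding real_root_gt_0_iff[OF zero_less_numeral]
    using assms ct(1) by (intro mult_pos_pos zero_less_power) auto
  have pos2: "0 < root 4 (c\<^sup>2 * t * (1 - t) ^ 3 * D)"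
    unfolding real_root_gt_0_iff[OF zero_less_numeral]
    using assms D(1) by (intro mult_pos_pos zero_less_power) auto
  have "c\<^sup>2 * t * (1 - t) ^ 3 * D \<le> 1"
    using assms D by (intro mult_le_one power_le_one mult_nonneg_nonneg zero_le_power) auto
  then show "1 \<le> K2_integrand c t"
    using pos2 by (simp add: K2_integrand_def flip: D_def)
  have "t\<^sup>2 * (1 - c * t) \<le> t * 1"
    using assms ct by (intro mult_mono) (simp_all add: power2_eq_square mult_left_le)
  then have "c\<^sup>2 * t * (1 - t) ^ 3 * (t\<^sup>2 * (1 - c * t)) \<le> c\<^sup>2 * t * (1 - t) ^ 3 * D"
    using assms D by (intro mult_left_mono) simp_all
  moreover have "c\<^sup>2 * t * (1 - t) ^ 3 * (t\<^sup>2 * (1 - c * t)) = c\<^sup>2 * t ^ 3 * (1 - t) ^ 3 * (1 - c * t)"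
    by algebra
  ultimately have "c\<^sup>2 * t ^ 3 * (1 - t) ^ 3 * (1 - c * t) \<le> c\<^sup>2 * t * (1 - t) ^ 3 * D"
    by (simp only:)
  then have "root 4 (c\<^sup>2 * t ^ 3 * (1 - t) ^ 3 * (1 - c * t)) \<le> root 4 (c\<^sup>2 * t * (1 - t) ^ 3 * D)"
    by (simp only: real_root_le_iff zero_less_numeral)
  then show "K2_integrand c t \<le> K1_integrand c t"
    using pos1 pos2 unfolding K1_integrand_def K2_integrand_def D_def[symmetric]
    by (simp only: frac_le zero_le_one order_refl)
qed

lemma K2_eq:
  assumes "0 < c" "c < 1"
  shows "K2_integrand c absolutely_integrable_on {0<..<1}"
    and "K2 c = integral {0<..<1} (K2_integrand c)"
proof -
  have meas: "K2_integrand c \<in> borel_measurable (lebesgue_on {0<..<1})"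
    unfolding K2_integrand_def by (intro measurable_restrict_space1 measurable_completion) measurable
  have "norm (K2_integrand c t) \<le> K1_integrand c t" if "t \<in> {0<..<1}" for t
    using K2_integrand_bounds[of c t] that assms by auto
  then show abs: "K2_integrand c absolutely_integrable_on {0<..<1}"
    by (intro measurable_bounded_by_integrable_imp_absolutely_integrable[OF meas _
          set_lebesgue_integral_eq_integral(1)[OF K1_integrand_absolutely_integrable[OF assms]]]) auto
  define D where "D t = c + (1 - c) * t" for t
  have D: "0 < D t" if "t \<in> {0<..<1}" for t
    using assms that by (auto simp: D_def intro!: add_pos_pos)
  have eq: "\<bar>- (c * (1 - c) / (D t)\<^sup>2)\<bar> * (1 / root 4 ((c / D t) ^ 3 * (c / D t - c) ^ 3 * (1 - c / D t)))
      = K2_integrand c t" if t: "t \<in> {0<..<1}" for t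
  proof -
    define p where "p = c * (1 - c) / (D t)\<^sup>2"
    define q where "q = 1 / D t"
    have q: "q * D t = 1" using D[OF t] by (simp add: q_def)
    have p: "0 < p" using D[OF t] assms by (simp add: p_def)
    have pq: "p = c * (1 - c) * q\<^sup>2" by (simp add: p_def q_def power_divide)
    have cq: "c / D t = c * q" by (simp add: q_def)
    have "c * q - c * (q * D t) = c * (1 - c) * (1 - t) * q" "q * D t - c * q = (1 - c) * t * q"
      unfolding D_def by algebra+
    then have "(c / D t) ^ 3 * (c / D t - c) ^ 3 * (1 - c / D t)
        = (c * q) ^ 3 * (c * (1 - c) * (1 - t) * q) ^ 3 * ((1 - c) * t * q)"
      unfolding q cq by (simp only: mult_1_right)
    \<comment> \<open>The transformed radicand has degree 7 in \<open>q\<close>, while the fourth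
      power of the Jacobian \<open>p\<close> has degree 8; the factor \<open>q * D t\<close>, which
      equals 1, makes up the difference and supplies the \<open>D t\<close> of
      \<open>K2_integrand\<close>.\<close>
    moreover have "(c * q) ^ 3 * (c * (1 - c) * (1 - t) * q) ^ 3 * ((1 - c) * t * q) * (q * D t)
        = p ^ 4 * (c\<^sup>2 * t * (1 - t) ^ 3 * D t)"
      unfolding pq by algebra
    ultimately have "(c / D t) ^ 3 * (c / D t - c) ^ 3 * (1 - c / D t) = p ^ 4 * (c\<^sup>2 * t * (1 - t) ^ 3 * D t)"
      by (simp only: q mult_1_right)
    then show ?thesis
      using p unfolding p_def[symmetric] K2_integrand_def D_def[symmetric]
      by (simp add: root_fourth_scale)
  qed
  have der: "((\<lambda>t. c / D t) has_field_derivative - (c * (1 - c) / (D t)\<^sup>2)) (at t within {0<..<1})"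
    if "t \<in> {0<..<1}" for t
    using D[OF that] unfolding D_def
    by (auto intro!: derivative_eq_intros simp: power2_eq_square)
  have inj: "inj_on (\<lambda>t. c / D t) {0<..<1}"
  proof (rule inj_onI)
    fix s t assume "s \<in> {0<..<1}" "t \<in> {0<..<1}" "c / D s = c / D t"
    then have "D s = D t"
      using D[of s] D[of t] assms by (simp add: field_simps)
    then show "s = t"
      using assms by (simp add: D_def)
  qed
  have img: "(\<lambda>t. c / D t) ` {0<..<1} = {c<..<1}"
  proof (intro equalityI subsetI)
    fix z assume z: "z \<in> {c<..<1}"
    \<comment> \<open>The preimage comes from solving \<open>D t = c / z\<close> for
      \<open>t\<close>.\<close>
    have "z = c / D ((c / z - c) / (1 - c))"
      using z assms by (simp add: D_def)
    moreover have "(c / z - c) / (1 - c) \<in> {0<..<1}"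
      using z assms mult_strict_left_mono[of z 1 c] by (auto simp: divide_simps) (simp_all add: algebra_simps)
    ultimately show "z \<in> (\<lambda>t. c / D t) ` {0<..<1}"
      by (rule image_eqI)
  next
    fix z assume "z \<in> (\<lambda>t. c / D t) ` {0<..<1}"
    then obtain t where t: "t \<in> {0<..<1}" "z = c / D t" by blast
    have "D t - c = (1 - c) * t" "1 - D t = (1 - c) * (1 - t)"
      by (simp_all add: D_def algebra_simps)
    then have "0 < D t - c" "0 < 1 - D t"
      using t assms by simp_all
    then have "c < D t" "D t < 1"
      by simp_all
    then show "z \<in> {c<..<1}"
      using t(2) D[OF t(1)] assms mult_strict_left_mono[of "D t" 1 c] by (simp add: pos_less_divide_eq)
  qed
  have "integral ((\<lambda>t. c / D t) ` {0<..<1}) (\<lambda>z. 1 / root 4 (z ^ 3 * (z - c) ^ 3 * (1 - z)))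
      = integral {0<..<1} (K2_integrand c)"
    by (rule integral_image_eq[OF abs _ inj der eq]) auto
  then show "K2 c = integral {0<..<1} (K2_integrand c)"
    unfolding K2_def img by (simp add: integral_open_interval_real)
qed

text \<open>The pointwise bounds give \<open>1 <= K2 c <= K1 c\<close>. Strictness then comes from
  \<open>1 < sqrt 2\<close> and the positivity of \<open>K1 c\<close>, not from a strict comparison
  of integrals.\<close>

lemma K2_less_sqrt2_K1:
  assumes "0 < c" "c < 1"
  shows "0 < K2 c" and "K2 c < sqrt 2 * K1 c"
proof -
  have int: "K1_integrand c integrable_on {0<..<1}" "K2_integrand c integrable_on {0<..<1}"
    using K1_integrand_absolutely_integrable[OF assms] K2_eq(1)[OF assms]
    by (auto simp: set_lebesgue_integral_eq_integral)
  have "integral {0<..<1::real} (\<lambda>_. 1) \<le> K2 c"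
    unfolding K2_eq(2)[OF assms] using int assms K2_integrand_bounds
    by (intro Henstock_Kurzweil_Integration.integral_le) (auto simp flip: integrable_on_Icc_iff_Ioo)
  then have one: "1 \<le> K2 c"
    by (simp flip: integral_open_interval_real)
  have le: "K2 c \<le> K1 c"
    unfolding K2_eq(2)[OF assms] K1_eq[OF assms] using int assms K2_integrand_bounds
    by (intro Henstock_Kurzweil_Integration.integral_le) auto
  show "0 < K2 c"
    using one by simp
  have "1 < sqrt (2::real)"
    by simp
  then have "1 * K1 c < sqrt 2 * K1 c"
    using one le by (intro mult_strict_right_mono) auto
  then show "K2 c < sqrt 2 * K1 c"
    using le by simp
qed

text \<open>\<open>K1\<close> cancels in \<open>u - v\<close>, and a factor \<open>sqrt 2\<close>
  cancels in the quotient, leaving \<open>s = (sqrt 2 * K1 c - K2 c) / K2 c\<close>. The two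
  inequations keep the denominator \<open>u ^ 2 - v ^ 2\<close> of \<open>tau_mat\<close> away from
  zero.\<close>

lemma tau_star_on_imaginary_axis:
  assumes "0 < c" "c < 1"
  obtains s where "0 < s" and "tau_star c = \<i> * complex_of_real s"
    and "per_u c \<noteq> per_v c" and "per_u c \<noteq> - per_v c"
proof
  let ?s = "(sqrt 2 * K1 c - K2 c) / K2 c"
  note K = K2_less_sqrt2_K1[OF assms]
  show "0 < ?s"
    using K by simp
  have d: "per_u c - per_v c = - 2 * \<i> * complex_of_real (sqrt 2 * K2 c)"
    by (simp add: per_u_def per_v_def algebra_simps)
  have "2 * K1 c - sqrt 2 * K2 c = sqrt 2 * (sqrt 2 * K1 c - K2 c)"
    by (simp add: right_diff_distrib flip: mult.assoc)
  moreover have "per_u c + per_v c = 2 * \<i> * complex_of_real (2 * K1 c - sqrt 2 * K2 c)"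
    by (simp add: per_u_def per_v_def algebra_simps)
  ultimately have s: "per_u c + per_v c = 2 * \<i> * complex_of_real (sqrt 2 * (sqrt 2 * K1 c - K2 c))"
    by simp
  have "sqrt 2 * K2 c \<noteq> 0" "sqrt 2 * (sqrt 2 * K1 c - K2 c) \<noteq> 0"
    using K by auto
  then have "per_u c - per_v c \<noteq> 0" "per_u c + per_v c \<noteq> 0"
    unfolding d s by (simp_all only: mult_eq_0_iff of_real_eq_0_iff) auto
  then show "per_u c \<noteq> per_v c" "per_u c \<noteq> - per_v c"
    by auto
  have "complex_of_real (sqrt 2 * (sqrt 2 * K1 c - K2 c)) / complex_of_real (sqrt 2 * K2 c)
      = complex_of_real ?s"
    unfolding of_real_divide[symmetric] by simp
  moreover have "- \<i> * (2 * \<i> * x / (- 2 * \<i> * y)) = \<i> * (x / y)" for x y :: complex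
    by simp
  ultimately show "tau_star c = \<i> * complex_of_real ?s"
    unfolding tau_star_def d s by simp
qed

subsection \<open>The lattice and the quadratic form\<close>

lemmas vec4_simps = vec_eq_iff forall_4 sum_4 matrix_matrix_mult_def vector_matrix_mult_def transpose_def

text \<open>The Leibniz sum is evaluated by splitting off one index at a time from the set being
  permuted, until only permutations of a singleton remain.\<close>

lemma det_L_mat: "det (L_mat :: int^4^4) = - 4"
proof -
  have f1: "finite {2::4, 3, 4}" "1 \<notin> {2::4, 3, 4}"
    by auto
  have f2: "finite {3::4, 4}" "2 \<notin> {3::4, 4}"
    by auto
  have f3: "finite {4::4}" "3 \<notin> {4::4}"
    by auto
  show ?thesis
    unfolding det_def UNIV_4
    unfolding sum_over_permutations_insert[OF f1]
    unfolding sum_over_permutations_insert[OF f2]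
    unfolding sum_over_permutations_insert[OF f3]
    unfolding permutes_sing
    by (simp add: sign_swap_id permutation_swap_id sign_compose sign_id swap_id_eq permutation_compose L_mat_def)
qed

lemma L_map_eq:
  "L_map n = vector [n $ 1 + n $ 2 + n $ 3 + n $ 4, n $ 1 + n $ 2 + n $ 3 - n $ 4,
    n $ 1 + n $ 2 + 2 * n $ 3, n $ 1 - n $ 2]"
  by (simp add: L_map_def L_mat_def vec4_simps)

text \<open>\<open>L_mat\<close> is symmetric, and so is this inverse; this is why the formulas for
  \<open>n\<close> in terms of \<open>r\<close> and for \<beta> in terms of \<open>b\<close> have
  the same coefficients.\<close>

definition L_inv :: "real^4^4" where
  "L_inv = vector
     [vector [1/2, 1/2, - 1/2, 1/2],
      vector [1/2, 1/2, - 1/2, - 1/2],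
      vector [- 1/2, - 1/2, 1, 0],
      vector [1/2, - 1/2, 0, 0]]"

lemma matrix_inv_L_mat: "matrix_inv L_mat = L_inv"
proof -
  have L: "L_mat ** L_inv = mat 1" "L_inv ** L_mat = mat 1"
    by (simp_all add: L_mat_def L_inv_def vec4_simps mat_def)
  \<comment> \<open>\<open>matrix_inv\<close> is a choice of some two-sided inverse:
    \<open>L_inv\<close> shows that the choice succeeds, and uniqueness of inverses then identifies
    the two.\<close>
  have "L_mat ** matrix_inv (L_mat :: real^4^4) = mat 1 \<and> matrix_inv L_mat ** (L_mat::real^4^4) = mat 1"
    unfolding matrix_inv_def
    by (rule someI[where x = L_inv]) (use L in simp)
  then show ?thesis
    by (metis L(2) matrix_mul_assoc matrix_mul_lid matrix_mul_rid)
qed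

lemma beta_vec_eq:
  "beta_vec b = vector [(b $ 1 + b $ 2 - b $ 3 + b $ 4) / 2, (b $ 1 + b $ 2 - b $ 3 - b $ 4) / 2,
     b $ 3 - (b $ 1 + b $ 2) / 2, (b $ 1 - b $ 2) / 2]"
  by (simp add: beta_vec_def matrix_inv_L_mat L_inv_def of_int_vec_def vec4_simps field_simps)

lemma bij_L_map: "bij_betw L_map UNIV Lambda"
proof (rule bij_betw_imageI)
  show "inj L_map"
    by (rule injI) (simp add: L_map_eq vec_eq_iff forall_4)
  show "range L_map = Lambda"
  proof (intro equalityI subsetI)
    fix r assume "r \<in> range L_map"
    then show "r \<in> Lambda"
      by (auto simp: L_map_eq Lambda_def cong_iff_dvd_diff)
  next
    fix r assume "r \<in> Lambda"
    then obtain i j where "r $ 1 - r $ 2 = 2 * i" "r $ 3 - r $ 4 = 2 * j"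
      unfolding Lambda_def mem_Collect_eq cong_iff_dvd_diff dvd_def by blast
    \<comment> \<open>This is the asserted inverse with the halves eliminated through
      \<open>i\<close> and \<open>j\<close>, which makes its integrality visible.\<close>
    then have "r = L_map (vector [r $ 2 + i - j, r $ 2 + i - r $ 3 + j, r $ 3 - r $ 2 - i, i])"
      by (simp add: L_map_eq vec_eq_iff forall_4)
    then show "r \<in> range L_map"
      by (rule range_eqI)
  qed
qed

lemma inv_L_map:
  assumes "r \<in> Lambda" and "n = the_inv_into UNIV L_map r"
  shows "real_of_int (n $ 1) = (r $ 1 + r $ 2 - r $ 3 + r $ 4) / 2
        \<and> real_of_int (n $ 2) = (r $ 1 + r $ 2 - r $ 3 - r $ 4) / 2
        \<and> real_of_int (n $ 3) = r $ 3 - (r $ 1 + r $ 2) / 2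
        \<and> real_of_int (n $ 4) = (r $ 1 - r $ 2) / 2"
proof -
  have "r = L_map n"
    using assms bij_L_map by (metis bij_betw_def f_the_inv_into_f)
  then show ?thesis
    by (simp add: L_map_eq add_divide_distrib diff_divide_distrib)
qed

section \<open>The index of the sublattice\<close>

lemma comm_group_Z4: "comm_group Z4"
  by (rule comm_groupI) (auto simp: Z4_def algebra_simps intro: exI[of _ "- _"])

lemma inv_Z4: "inv\<^bsub>Z4\<^esub> x = - x"
  using comm_group_Z4 by (intro group.inv_equality) (auto simp: comm_group_def Z4_def)

lemma subgroup_Lambda: "subgroup Lambda Z4"
proof (rule subgroup.intro)
  fix x assume "x \<in> Lambda"
  then show "inv\<^bsub>Z4\<^esub> x \<in> Lambda"
    by (simp add: inv_Z4 Lambda_def cong_minus_minus_iff)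
qed (auto simp: Z4_def Lambda_def intro: cong_add)

lemma card_rcosets_Lambda: "card (rcosets\<^bsub>Z4\<^esub> Lambda) = 4"
proof -
  \<comment> \<open>The cosets are the fibres of the pair of parities of
    \<open>x $ 1 - x $ 2\<close> and \<open>x $ 3 - x $ 4\<close>; all four pairs occur.\<close>
  define C where "C = (\<lambda>(i, j). {x :: int^4. (odd (x $ 1 - x $ 2) = i) \<and> (odd (x $ 3 - x $ 4) = j)})"
  have coset: "Lambda #>\<^bsub>Z4\<^esub> a = C (odd (a $ 1 - a $ 2), odd (a $ 3 - a $ 4))" for a
  proof -
    have "Lambda #>\<^bsub>Z4\<^esub> a = {x. x - a \<in> Lambda}"
      unfolding r_coset_def Z4_def by (auto simp: algebra_simps) 
    also have "\<dots> = C (odd (a $ 1 - a $ 2), odd (a $ 3 - a $ 4))"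
      by (auto simp: C_def Lambda_def cong_iff_dvd_diff)
    finally show ?thesis .
  qed
  have ex: "C (i, j) = Lambda #>\<^bsub>Z4\<^esub> (vector [of_bool i, 0, of_bool j, 0])" for i j
    by (simp add: coset)
  have "rcosets\<^bsub>Z4\<^esub> Lambda = range C"
  proof
    show "range C \<subseteq> rcosets\<^bsub>Z4\<^esub> Lambda"
      using ex by (auto simp: RCOSETS_def Z4_def)
  qed (auto simp: RCOSETS_def coset)
  moreover have "inj C"
  proof (rule injI)
    fix p q :: "bool \<times> bool" assume "C p = C q"
    moreover have "vector [of_bool (fst p), 0, of_bool (snd p), 0] \<in> C p"
      by (auto simp: C_def case_prod_unfold)
    ultimately have "vector [of_bool (fst p), 0, of_bool (snd p), 0] \<in> C q"
      by simp
    then show "p = q"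
      by (auto simp: C_def case_prod_unfold prod_eq_iff)
  qed
  ultimately show ?thesis
    by (simp add: card_image card_UNIV_bool flip: UNIV_Times_UNIV)
qed

text \<open>With \<open>q = 1 / (u ^ 2 - v ^ 2)\<close> both \<tau>* and its reciprocal become
  polynomial in \<open>u\<close>, \<open>v\<close>, \<open>q\<close>, namely
  \<open>- \<i> * ((u + v) ^ 2 * q)\<close> and \<open>\<i> * ((u - v) ^ 2 * q)\<close>. The vector
  is complex so that the identity also covers the half-integral shifts in a theta series.\<close>

lemma quad_form_tau_mat:
  fixes x :: "complex^4"
  assumes "per_u c \<noteq> per_v c" "per_u c \<noteq> - per_v c"
  shows "1 / 2 * quad_form (tau_mat c) x
    = tau_star c / 4 * (x $ 1 + x $ 2 + x $ 3 + x $ 4)\<^sup>2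
      - 1 / (4 * tau_star c) * (x $ 1 + x $ 2 + x $ 3 - x $ 4)\<^sup>2
      + \<i> / 4 * (x $ 1 + x $ 2 + 2 * x $ 3)\<^sup>2 + \<i> / 4 * (x $ 1 - x $ 2)\<^sup>2"
proof -
  define u v where "u = per_u c" and "v = per_v c"
  have nz: "u - v \<noteq> 0" "u + v \<noteq> 0"
    using assms by (auto simp: u_def v_def add_eq_0_iff)
  define q where "q = 1 / (u\<^sup>2 - v\<^sup>2)"
  have uv: "u\<^sup>2 - v\<^sup>2 = (u - v) * (u + v)"
    by (simp add: power2_eq_square algebra_simps)
  have q: "q * (u\<^sup>2 - v\<^sup>2) = 1"
    using nz by (simp add: q_def uv)
  have tau: "tau_star c = - \<i> * ((u + v)\<^sup>2 * q)"
    using nz unfolding q_def uv tau_star_def u_def[symmetric] v_def[symmetric]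
    by (simp add: power2_eq_square)
  have "(- \<i> * ((u + v)\<^sup>2 * q)) * (\<i> * ((u - v)\<^sup>2 * q)) = (q * (u\<^sup>2 - v\<^sup>2))\<^sup>2 * - (\<i> * \<i>)"
    by algebra
  then have "tau_star c * (\<i> * ((u - v)\<^sup>2 * q)) = 1"
    unfolding tau q by simp
  then have inv: "1 / (4 * tau_star c) = \<i> * ((u - v)\<^sup>2 * q) / 4"
    by (metis (no_types) divide_divide_eq_left' inverse_eq_divide inverse_unique)
  have "\<i> / (u\<^sup>2 - v\<^sup>2) = \<i> * q"
    by (simp add: q_def)
  \<comment> \<open>The last two squares carry the factor \<open>q * (u ^ 2 - v ^ 2)\<close>, equal
    to 1, so that both sides are linear in \<open>q\<close> and comparing them is pure polynomial
    arithmetic.\<close>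
  then have "1 / 2 * quad_form (tau_mat c) x
    = - \<i> * ((u + v)\<^sup>2 * q) / 4 * (x $ 1 + x $ 2 + x $ 3 + x $ 4)\<^sup>2
      - \<i> * ((u - v)\<^sup>2 * q) / 4 * (x $ 1 + x $ 2 + x $ 3 - x $ 4)\<^sup>2
      + \<i> / 4 * (q * (u\<^sup>2 - v\<^sup>2)) * (x $ 1 + x $ 2 + 2 * x $ 3)\<^sup>2
      + \<i> / 4 * (q * (u\<^sup>2 - v\<^sup>2)) * (x $ 1 - x $ 2)\<^sup>2"
    unfolding quad_form_def tau_mat_def Let_def sum_4 vec_lambda_beta vector_4 u_def[symmetric] v_def[symmetric]
    by (simp add: field_simps power2_eq_square)
  then show ?thesis
    unfolding inv q by (simp add: tau)
qed

subsection \<open>Theta series\<close>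

lemma abs_summable_on_times:
  fixes f :: "'a \<Rightarrow> 'c::{real_normed_div_algebra,banach}" and g :: "'b \<Rightarrow> 'c"
  assumes "(\<lambda>x. norm (f x)) summable_on A" and "(\<lambda>y. norm (g y)) summable_on B"
  shows "(\<lambda>p. norm (case p of (x, y) \<Rightarrow> f x * g y)) summable_on A \<times> B"
  using assms unfolding Infinite_Sum.abs_summable_on_Sigma_iff
  by (simp add: norm_mult infsum_cmult_right' infsum_nonneg summable_on_cmult_right summable_on_cmult_left)

lemma infsum_times:
  fixes f :: "'a \<Rightarrow> 'c::{real_normed_div_algebra,banach}" and g :: "'b \<Rightarrow> 'c"
  assumes "(\<lambda>x. norm (f x)) summable_on A" and "(\<lambda>y. norm (g y)) summable_on B"
  shows "infsum f A * infsum g B = (\<Sum>\<^sub>\<infinity>(x, y)\<in>A \<times> B. f x * g y)"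
proof -
  have "(\<lambda>(x, y). f x * g y) summable_on A \<times> B"
    by (rule abs_summable_summable[OF abs_summable_on_times[OF assms]])
  from infsum_Sigma'_banach[OF this] show ?thesis
    by (simp add: infsum_cmult_right' infsum_cmult_left')
qed

lemma summable_on_geometric_int:
  fixes q :: real
  assumes "0 \<le> q" "q < 1"
  shows "(\<lambda>k::int. q ^ nat \<bar>k\<bar>) summable_on UNIV"
proof -
  have 1: "(\<lambda>n::nat. q ^ n) summable_on UNIV"
    using assms by (simp add: summable_on_UNIV_nonneg_real_iff summable_geometric)
  have "(\<lambda>k::int. q ^ nat \<bar>k\<bar>) summable_on range int"
    using 1 by (simp add: summable_on_reindex o_def)
  moreover have "(\<lambda>k::int. q ^ nat \<bar>k\<bar>) summable_on range (\<lambda>n. - int n)"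
    using 1 by (simp add: summable_on_reindex inj_on_def o_def)
  moreover have "(UNIV :: int set) = range int \<union> range (\<lambda>n. - int n)"
  proof (intro equalityI subsetI)
    fix k :: int
    show "k \<in> range int \<union> range (\<lambda>n. - int n)" by (cases k rule: int_cases2) auto
  qed auto
  ultimately show ?thesis
    using summable_on_union by (metis (lifting))
qed

section \<open>Theta series in degree one\<close>

definition theta_term :: "complex \<Rightarrow> real \<Rightarrow> real \<Rightarrow> int \<Rightarrow> complex" where
  "theta_term \<tau> a b k =
     (let x = complex_of_real (of_int k + a / 2)
      in exp (2 * pi * \<i> * (1 / 2 * (x\<^sup>2 * \<tau>) + x * complex_of_real (b / 2))))"

lemma theta1_eq_infsum: "theta1 a b \<tau> = infsum (theta_term \<tau> a b) UNIV"
proof -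
  have bij: "bij_betw (\<lambda>v::int^1. v $ 1) UNIV UNIV"
    by (rule bij_betwI[where g = vec]) (auto simp: vec_eq_iff)
  show ?thesis
    unfolding theta1_def theta_def theta_term_def quad_form_def
      infsum_reindex_bij_betw[OF bij, symmetric]
    by (simp add: Let_def power2_eq_square mult_ac)
qed

text \<open>The characteristic \<open>b\<close> and the real part of \<tau> contribute only phases,
  since \<open>k + a / 2\<close> is real.\<close>

lemma norm_theta_term:
  "norm (theta_term \<tau> a b k) = exp (- pi * Im \<tau> * (of_int k + a / 2)\<^sup>2)"
proof -
  have "Re (2 * pi * \<i> * (1 / 2 * ((complex_of_real x)\<^sup>2 * \<tau>) + complex_of_real x * complex_of_real (b / 2)))
     = - pi * Im \<tau> * x\<^sup>2" for x
    by (simp flip: of_real_power)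
  then show ?thesis
    unfolding theta_term_def Let_def norm_exp_eq_Re by (simp only:)
qed

lemma theta_term_abs_summable:
  assumes "Im \<tau> > 0"
  shows "(\<lambda>k. norm (theta_term \<tau> a b k)) summable_on UNIV"
proof (rule Infinite_Sum.abs_summable_on_comparison_test')
  define q where "q = exp (- 2 * pi * Im \<tau>)"
  define C where "C = exp (pi * Im \<tau> * (1 + \<bar>a\<bar>))"
  show "(\<lambda>k::int. C * q ^ nat \<bar>k\<bar>) summable_on UNIV"
    using assms by (intro summable_on_cmult_right summable_on_geometric_int) (auto simp: q_def)
  fix k :: int
  define x where "x = of_int k + a / 2"
  \<comment> \<open>Expanding \<open>(\<bar>x\<bar> - 1) ^ 2 >= 0\<close> trades the Gaussian
    exponent for a linear one; this yields the ratio \<open>q\<close>, and the leftover constants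
    form \<open>C\<close>.\<close>
  have "2 * \<bar>x\<bar> \<le> x\<^sup>2 + 1"
    using sum_squares_ge_zero[of "\<bar>x\<bar> - 1" 0] by (simp add: power2_eq_square algebra_simps)
  moreover have "\<bar>x\<bar> \<ge> \<bar>of_int k\<bar> - \<bar>a\<bar> / 2"
    unfolding x_def by linarith
  ultimately have "2 * \<bar>of_int k\<bar> - (1 + \<bar>a\<bar>) \<le> x\<^sup>2"
    by linarith
  then have "pi * Im \<tau> * (2 * \<bar>of_int k\<bar> - (1 + \<bar>a\<bar>)) \<le> pi * Im \<tau> * x\<^sup>2"
    using assms by (intro mult_left_mono) auto
  then have "exp (- (pi * Im \<tau> * x\<^sup>2)) \<le> exp (pi * Im \<tau> * (1 + \<bar>a\<bar>) + \<bar>of_int k\<bar> * (- 2 * pi * Im \<tau>))"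
    by (simp add: algebra_simps)
  also have "\<dots> = C * q ^ nat \<bar>k\<bar>"
    unfolding C_def q_def exp_add exp_of_nat_mult[symmetric] by simp
  finally show "norm (theta_term \<tau> a b k) \<le> C * q ^ nat \<bar>k\<bar>"
    by (simp add: norm_theta_term x_def)
qed

text \<open>The exponent grows by \<open>pi * \<i> * (k + a / 2)\<close>: the part with
  \<open>k\<close> gives the sign, the part with \<open>a\<close> a constant phase.\<close>

lemma theta_term_shift:
  "theta_term \<tau> a (b + 1) k = exp (pi * \<i> * a / 2) * (if even k then 1 else - 1) * theta_term \<tau> a b k"
proof -
  have "exp (pi * \<i> * of_int k) = (if even k then 1 else - 1)"
  proof (cases "even k")
    case True
    then obtain j where "k = 2 * j" by (elim evenE)
    then have k: "pi * \<i> * of_int k = (2 * of_int j * pi) * \<i>" by simp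
    show ?thesis unfolding k using True exp_integer_2pi[of "of_int j"] by (simp only: Ints_of_int if_True)
  next
    case False
    then obtain j where "k = 2 * j + 1" by (elim oddE)
    then have k: "pi * \<i> * of_int k = (2 * of_int j * pi) * \<i> + pi * \<i>" by (simp add: algebra_simps)
    show ?thesis unfolding k exp_add using False exp_integer_2pi[of "of_int j"]
      by (simp only: Ints_of_int if_False exp_pi_i mult_1)
  qed
  moreover have "theta_term \<tau> a (b + 1) k = exp (pi * \<i> * a / 2) * exp (pi * \<i> * of_int k) * theta_term \<tau> a b k"
    unfolding theta_term_def Let_def exp_add[symmetric]
    by (rule arg_cong[of _ _ exp]) (simp add: field_simps)
  ultimately show ?thesis by simp
qed

text \<open>The exponential prefactor cancels the constant phases of both shifts, so the terms at
  \<open>(k, l)\<close> combine with the factor \<open>1 + (-1) ^ (k + l)\<close>, which is 2 or 0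
  according to the parity condition.\<close>

lemma theta1_sum_over_parity:
  assumes "Im \<tau> > 0" "Im \<sigma> > 0"
  shows "theta1 a b \<tau> * theta1 a' b' \<sigma>
      + exp (- 2 * pi * \<i> * ((a + a') / 4)) * (theta1 a (b + 1) \<tau> * theta1 a' (b' + 1) \<sigma>)
    = 2 * (\<Sum>\<^sub>\<infinity>(k, l) | [k = l] (mod 2). theta_term \<tau> a b k * theta_term \<sigma> a' b' l)"
proof -
  let ?f = "\<lambda>(k, l). theta_term \<tau> a b k * theta_term \<sigma> a' b' l"
  let ?g = "\<lambda>(k, l). theta_term \<tau> a (b + 1) k * theta_term \<sigma> a' (b' + 1) l"
  let ?e = "exp (- 2 * pi * \<i> * ((a + a') / 4))"
  note summ = abs_summable_summable[OF abs_summable_on_times[OF theta_term_abs_summable[OF assms(1)] theta_term_abs_summable[OF assms(2)]]]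
  have e: "?e * (exp (pi * \<i> * a / 2) * exp (pi * \<i> * a' / 2)) = 1"
    unfolding exp_add[symmetric] exp_eq_1 by (simp add: field_simps)
  have eq: "?f p + ?e * ?g p = (if p \<in> {(k, l). [k = l] (mod 2)} then 2 * ?f p else 0)" for p
  proof -
    obtain k l where p: "p = (k, l)" by (cases p)
    have "?e * ?g p = ?e * (exp (pi * \<i> * a / 2) * exp (pi * \<i> * a' / 2))
        * ((if even k then 1 else - 1) * (if even l then 1 else - 1)) * ?f p"
      unfolding theta_term_shift p by (simp only: mult_ac prod.case)
    also have "\<dots> = (if [k = l] (mod 2) then 1 else - 1) * ?f p"
      unfolding e by (auto simp: cong_iff_dvd_diff)
    finally show ?thesis by (simp add: p)
  qed
  have "theta1 a b \<tau> * theta1 a' b' \<sigma> + ?e * (theta1 a (b + 1) \<tau> * theta1 a' (b' + 1) \<sigma>)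
      = infsum ?f UNIV + ?e * infsum ?g UNIV"
    unfolding theta1_eq_infsum using assms by (simp add: infsum_times theta_term_abs_summable)
  also have "\<dots> = (\<Sum>\<^sub>\<infinity>p. ?f p + ?e * ?g p)"
    using summ by (simp add: infsum_add infsum_cmult_right' summable_on_cmult_right)
  also have "\<dots> = (\<Sum>\<^sub>\<infinity>p | p \<in> {(k, l). [k = l] (mod 2)}. 2 * ?f p)"
    unfolding eq by (rule infsum_cong_neutral) auto
  finally show ?thesis
    by (simp add: infsum_cmult_right' case_prod_unfold)
qed

section \<open>The degree-four theta series as a product of parity-restricted sums\<close>

lemma theta_tau_mat_reindex:
  fixes a b :: "int^4"
  assumes "per_u c \<noteq> per_v c" "per_u c \<noteq> - per_v c"
  defines "\<alpha> \<equiv> L_map a" and "\<beta> \<equiv> beta_vec b"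
  defines "P \<equiv> {(k, l). [k = l] (mod 2)} :: (int \<times> int) set"
  shows "theta (of_int_vec a) (of_int_vec b) (tau_mat c)
    = (\<Sum>\<^sub>\<infinity>((k, l), (m, n))\<in>P \<times> P.
        theta_term (tau_star c / 2) (\<alpha> $ 1) (\<beta> $ 1) k
        * theta_term (- 1 / (2 * tau_star c)) (\<alpha> $ 2) (\<beta> $ 2) l
        * (theta_term (\<i> / 2) (\<alpha> $ 3) (\<beta> $ 3) m * theta_term (\<i> / 2) (\<alpha> $ 4) (\<beta> $ 4) n))"
proof -
  \<comment> \<open>Each congruence defining \<open>Lambda\<close> involves only one of these two
    pairs of coordinates, so \<open>Lambda\<close> becomes a product
    \<open>P \<times> P\<close>.\<close>
  define h where "h r = ((r $ 1, r $ 2), (r $ 3, r $ 4))" for r :: "int^4"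
  have "bij_betw h Lambda (P \<times> P)"
    by (rule bij_betwI[where g = "\<lambda>((k, l), (m, n)). vector [k, l, m, n]"])
      (auto simp: h_def P_def Lambda_def vec_eq_iff forall_4)
  then have bij: "bij_betw (\<lambda>n. h (L_map n)) UNIV (P \<times> P)"
    using bij_betw_trans[OF bij_L_map] by (simp add: o_def)
  show ?thesis
    unfolding theta_def infsum_reindex_bij_betw[OF bij, symmetric]
  proof (rule infsum_cong)
    fix k :: "int^4"
    define x :: "complex^4" where "x = (\<chi> i. complex_of_real (of_int (k $ i) + of_int_vec a $ i / 2))"
    define r where "r = L_map k"
    define X where "X i = complex_of_real (of_int (r $ i) + of_int (\<alpha> $ i) / 2)" for i
    \<comment> \<open>By linearity, the shift of \<open>k\<close> by \<open>a / 2\<close> becomes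
      the shift of \<open>r\<close> by \<alpha> / 2.\<close>
    have X: "X 1 = x $ 1 + x $ 2 + x $ 3 + x $ 4" "X 2 = x $ 1 + x $ 2 + x $ 3 - x $ 4"
        "X 3 = x $ 1 + x $ 2 + 2 * x $ 3" "X 4 = x $ 1 - x $ 2"
      by (simp_all add: X_def x_def r_def \<alpha>_def L_map_eq of_int_vec_def add_divide_distrib diff_divide_distrib)
    \<comment> \<open>Each coefficient is written as one half of a theta argument; hence the halved
      arguments in the product formula.\<close>
    have quad: "1 / 2 * quad_form (tau_mat c) x
        = 1 / 2 * ((X 1)\<^sup>2 * (tau_star c / 2)) + 1 / 2 * ((X 2)\<^sup>2 * (- 1 / (2 * tau_star c)))
          + (1 / 2 * ((X 3)\<^sup>2 * (\<i> / 2)) + 1 / 2 * ((X 4)\<^sup>2 * (\<i> / 2)))"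
      unfolding quad_form_tau_mat[OF assms(1,2)] X by (simp add: mult_ac)
    \<comment> \<open>The pairing is preserved because \<open>x\<close> is transformed by the
      transpose of L and \<open>b\<close> by the inverse of L.\<close>
    have lin: "(\<Sum>i\<in>UNIV. x $ i * complex_of_real (of_int_vec b $ i / 2))
        = X 1 * complex_of_real (\<beta> $ 1 / 2) + X 2 * complex_of_real (\<beta> $ 2 / 2)
          + (X 3 * complex_of_real (\<beta> $ 3 / 2) + X 4 * complex_of_real (\<beta> $ 4 / 2))"
      unfolding X sum_4 \<beta>_def beta_vec_eq by (simp add: of_int_vec_def field_simps)
    have dist: "w * (q1 + q2 + (q3 + q4) + (l1 + l2 + (l3 + l4)))
        = w * (q1 + l1) + w * (q2 + l2) + (w * (q3 + l3) + w * (q4 + l4))"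
      for w q1 q2 q3 q4 l1 l2 l3 l4 :: complex
      by (simp add: distrib_left)
    show "(let x = \<chi> i. complex_of_real (of_int (k $ i) + of_int_vec a $ i / 2)
        in exp (2 * pi * \<i> * (1 / 2 * quad_form (tau_mat c) x
          + (\<Sum>i\<in>UNIV. x $ i * complex_of_real (of_int_vec b $ i / 2)))))
      = (\<lambda>((k, l), (m, n)).
          theta_term (tau_star c / 2) (\<alpha> $ 1) (\<beta> $ 1) k
          * theta_term (- 1 / (2 * tau_star c)) (\<alpha> $ 2) (\<beta> $ 2) l
          * (theta_term (\<i> / 2) (\<alpha> $ 3) (\<beta> $ 3) m * theta_term (\<i> / 2) (\<alpha> $ 4) (\<beta> $ 4) n)) (h (L_map k))"
      unfolding Let_def x_def[symmetric] quad lin h_def prod.case theta_term_def r_def[symmetric]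
        X_def[symmetric] exp_add[symmetric]
      by (simp only: dist)
  qed
qed

lemma theta_tau_mat:
  fixes a b :: "int^4"
  assumes "0 < c" "c < 1"
  defines "\<alpha> \<equiv> L_map a" and "\<beta> \<equiv> beta_vec b"
  shows "theta (of_int_vec a) (of_int_vec b) (tau_mat c)
          = 1 / 4 * (\<Sum>\<nu>1\<in>{0, 1::int}. \<Sum>\<nu>2\<in>{0, 1::int}.
              exp (- 2 * pi * \<i> *
                (of_int ((\<alpha> $ 1 + \<alpha> $ 2) * \<nu>1 + (\<alpha> $ 3 + \<alpha> $ 4) * \<nu>2) / 4))
              * theta1 (of_int (\<alpha> $ 1)) (\<beta> $ 1 + of_int \<nu>1) (tau_star c / 2)
              * theta1 (of_int (\<alpha> $ 2)) (\<beta> $ 2 + of_int \<nu>1) (- 1 / (2 * tau_star c))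
              * theta1 (of_int (\<alpha> $ 3)) (\<beta> $ 3 + of_int \<nu>2) (\<i> / 2)
              * theta1 (of_int (\<alpha> $ 4)) (\<beta> $ 4 + of_int \<nu>2) (\<i> / 2))"
proof -
  obtain s where s: "0 < s" "tau_star c = \<i> * complex_of_real s"
    and uv: "per_u c \<noteq> per_v c" "per_u c \<noteq> - per_v c"
    using tau_star_on_imaginary_axis[OF assms(1,2)] .
  have "- 1 / (2 * tau_star c) = \<i> * complex_of_real (1 / (2 * s))"
    using s(1) by (simp add: s(2) field_simps)
  then have im: "0 < Im (tau_star c / 2)" "0 < Im (- 1 / (2 * tau_star c))" "0 < Im (\<i> / 2)"
    using s by simp_all
  define P :: "(int \<times> int) set" where "P = {(k, l). [k = l] (mod 2)}"
  define A where "A = (\<lambda>(k, l). theta_term (tau_star c / 2) (\<alpha> $ 1) (\<beta> $ 1) k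
        * theta_term (- 1 / (2 * tau_star c)) (\<alpha> $ 2) (\<beta> $ 2) l)"
  define B where "B = (\<lambda>(m, n). theta_term (\<i> / 2) (\<alpha> $ 3) (\<beta> $ 3) m * theta_term (\<i> / 2) (\<alpha> $ 4) (\<beta> $ 4) n)"
  have "(\<lambda>p. norm (A p)) summable_on UNIV \<times> UNIV" "(\<lambda>p. norm (B p)) summable_on UNIV \<times> UNIV"
    unfolding A_def B_def by (intro abs_summable_on_times theta_term_abs_summable im)+
  then have summ: "(\<lambda>p. norm (A p)) summable_on P" "(\<lambda>p. norm (B p)) summable_on P"
    by (auto elim: summable_on_subset_banach)
  have "theta (of_int_vec a) (of_int_vec b) (tau_mat c) = (\<Sum>\<^sub>\<infinity>(p, q)\<in>P \<times> P. A p * B q)"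
    unfolding theta_tau_mat_reindex[OF uv] P_def A_def B_def \<alpha>_def \<beta>_def
    by (simp only: case_prod_unfold)
  also have "\<dots> = infsum A P * infsum B P"
    using infsum_times[OF summ] by simp
  \<comment> \<open>Each of the two parity sums is doubled to match
    \<open>theta1_sum_over_parity\<close>; this is the origin of the factor 1/4.\<close>
  also have "\<dots> = 1 / 4 * ((2 * infsum A P) * (2 * infsum B P))"
    by simp
  finally have main: "theta (of_int_vec a) (of_int_vec b) (tau_mat c) = 1 / 4 * ((2 * infsum A P) * (2 * infsum B P))" .
  \<comment> \<open>Only the summand with both \<nu>1 and \<nu>2 equal to 1 has a phase involving
    both pairs; splitting it lets the fourfold sum arise by multiplying out two binomials.\<close>
  have e: "exp (- 2 * pi * \<i> * (of_int (\<alpha> $ 1 + \<alpha> $ 2 + (\<alpha> $ 3 + \<alpha> $ 4)) / 4))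
      = exp (- 2 * pi * \<i> * (of_int (\<alpha> $ 1 + \<alpha> $ 2) / 4)) * exp (- 2 * pi * \<i> * (of_int (\<alpha> $ 3 + \<alpha> $ 4) / 4))"
    unfolding exp_add[symmetric] by (rule arg_cong[of _ _ exp]) (simp add: field_simps)
  have "2 * infsum A P = theta1 (\<alpha> $ 1) (\<beta> $ 1) (tau_star c / 2) * theta1 (\<alpha> $ 2) (\<beta> $ 2) (- 1 / (2 * tau_star c))
      + exp (- 2 * pi * \<i> * (of_int (\<alpha> $ 1 + \<alpha> $ 2) / 4)) *
        (theta1 (\<alpha> $ 1) (\<beta> $ 1 + 1) (tau_star c / 2) * theta1 (\<alpha> $ 2) (\<beta> $ 2 + 1) (- 1 / (2 * tau_star c)))"
    unfolding A_def P_def theta1_sum_over_parity[OF im(1,2), symmetric] by simp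
  moreover have "2 * infsum B P = theta1 (\<alpha> $ 3) (\<beta> $ 3) (\<i> / 2) * theta1 (\<alpha> $ 4) (\<beta> $ 4) (\<i> / 2)
      + exp (- 2 * pi * \<i> * (of_int (\<alpha> $ 3 + \<alpha> $ 4) / 4)) *
        (theta1 (\<alpha> $ 3) (\<beta> $ 3 + 1) (\<i> / 2) * theta1 (\<alpha> $ 4) (\<beta> $ 4 + 1) (\<i> / 2))"
    unfolding B_def P_def theta1_sum_over_parity[OF im(3,3), symmetric] by simp
  moreover have "(\<Sum>\<nu>\<in>{0, 1::int}. F \<nu>) = F 0 + F 1" for F :: "int \<Rightarrow> complex"
    by simp
  ultimately show ?thesis
    unfolding main
    by (simp only: e mult_zero_right mult_1_right add_0_left add_0_right of_int_0 of_int_1 div_0 exp_zero mult_1_left)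
      (simp only: ring_distribs mult_ac add_ac)
qed

theorem proposition4p3:
  fixes c :: real
  assumes "0 < c" and "c < 1"
  shows "det (L_mat :: int^4^4) = - 4
    \<and> subgroup Lambda Z4
    \<and> card (rcosets\<^bsub>Z4\<^esub> Lambda) = 4
    \<and> bij_betw L_map UNIV Lambda
    \<and> (\<forall>r\<in>Lambda. let n = the_inv_into UNIV L_map r in
          real_of_int (n $ 1) = (r $ 1 + r $ 2 - r $ 3 + r $ 4) / 2
        \<and> real_of_int (n $ 2) = (r $ 1 + r $ 2 - r $ 3 - r $ 4) / 2
        \<and> real_of_int (n $ 3) = r $ 3 - (r $ 1 + r $ 2) / 2
        \<and> real_of_int (n $ 4) = (r $ 1 - r $ 2) / 2)
    \<and> (\<forall>n. let r = L_map n in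
          1 / 2 * quad_form (tau_mat c) (of_int_vec n)
          = tau_star c / 4 * (of_int (r $ 1))\<^sup>2 - 1 / (4 * tau_star c) * (of_int (r $ 2))\<^sup>2
            + \<i> / 4 * (of_int (r $ 3))\<^sup>2 + \<i> / 4 * (of_int (r $ 4))\<^sup>2)
    \<and> (\<forall>a b :: int^4. let \<alpha> = L_map a; \<beta> = beta_vec b in
          \<alpha> = vector [a $ 1 + a $ 2 + a $ 3 + a $ 4, a $ 1 + a $ 2 + a $ 3 - a $ 4,
                      a $ 1 + a $ 2 + 2 * a $ 3, a $ 1 - a $ 2]
        \<and> \<beta> = vector [(b $ 1 + b $ 2 - b $ 3 + b $ 4) / 2, (b $ 1 + b $ 2 - b $ 3 - b $ 4) / 2,
                      b $ 3 - (b $ 1 + b $ 2) / 2, (b $ 1 - b $ 2) / 2]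
        \<and> theta (of_int_vec a) (of_int_vec b) (tau_mat c)
          = 1 / 4 * (\<Sum>\<nu>1\<in>{0, 1::int}. \<Sum>\<nu>2\<in>{0, 1::int}.
              exp (- 2 * pi * \<i> *
                (of_int ((\<alpha> $ 1 + \<alpha> $ 2) * \<nu>1 + (\<alpha> $ 3 + \<alpha> $ 4) * \<nu>2) / 4))
              * theta1 (of_int (\<alpha> $ 1)) (\<beta> $ 1 + of_int \<nu>1) (tau_star c / 2)
              * theta1 (of_int (\<alpha> $ 2)) (\<beta> $ 2 + of_int \<nu>1) (- 1 / (2 * tau_star c))
              * theta1 (of_int (\<alpha> $ 3)) (\<beta> $ 3 + of_int \<nu>2) (\<i> / 2)
              * theta1 (of_int (\<alpha> $ 4)) (\<beta> $ 4 + of_int \<nu>2) (\<i> / 2)))"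
proof -
  have quad: "1 / 2 * quad_form (tau_mat c) (of_int_vec n)
      = tau_star c / 4 * (of_int (L_map n $ 1))\<^sup>2 - 1 / (4 * tau_star c) * (of_int (L_map n $ 2))\<^sup>2
        + \<i> / 4 * (of_int (L_map n $ 3))\<^sup>2 + \<i> / 4 * (of_int (L_map n $ 4))\<^sup>2" for n
    using tau_star_on_imaginary_axis[OF assms] quad_form_tau_mat[of c "of_int_vec n"]
    by (auto simp: L_map_eq of_int_vec_def)
  show ?thesis
    unfolding Let_def
    by (intro conjI allI ballI det_L_mat subgroup_Lambda card_rcosets_Lambda bij_L_map quad
        L_map_eq beta_vec_eq theta_tau_mat assms)
      (use inv_L_map in blast)+
qed

end
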